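(* Let $\Omega$ be a paracompact Hausdorff space and let $A\subseteq C(\Omega)_+$. Then $A$ is order bounded in $C(\Omega)$ if and only if it is locally bounded, i.e., for every $t\in\Omega$ there exist an open neighborhood $U$ of $t$ and a real number $r\geqslant 0$ such that $f(s)\leqslant r$ for all $f\in A$ and $s\in U$.
   Context: $C(\Omega)$ is the vector lattice of all real-valued continuous functions on $\Omega$ with pointwise operations and order, and $C(\Omega)_+$ is the set of its non-negative elements. A subset of a vector lattice is order bounded if it is contained in an order interval; for $A\subseteq C(\Omega)_+$ this means there is $g\in C(\Omega)$ with $f\leqslant g$ for all $f\in A$. *)

theory Defs
  imports "HOL-Analysis.Analysis"
begin

text \<open>Covers and refinements are sets of open sets. As in the library, separation axioms
  are not part of the definition; compare \<^const>\<open>compact_space\<close> and \<^const>\<open>Hausdorff_space\<close>.\<close>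

definition paracompact_space :: "'a topology \<Rightarrow> bool" where
  "paracompact_space X \<longleftrightarrow>
     (\<forall>\<U>. (\<forall>U\<in>\<U>. openin X U) \<and> \<Union>\<U> = topspace X \<longrightarrow>
        (\<exists>\<V>. (\<forall>V\<in>\<V>. openin X V) \<and> \<Union>\<V> = topspace X \<and>
             (\<forall>V\<in>\<V>. \<exists>U\<in>\<U>. V \<subseteq> U) \<and> locally_finite_in X \<V>))"

text \<open>A function on \<^term>\<open>topspace X\<close> is represented by the total function that is
  \<^const>\<open>undefined\<close> off \<^term>\<open>topspace X\<close>, so that equality in \<open>cfun X\<close> is equality
  of functions on the space. The order only looks at points of the space.\<close>

definition cfun :: "'a topology \<Rightarrow> ('a \<Rightarrow> real) set" where
  "cfun X = {f \<in> extensional (topspace X). continuous_map X euclideanreal f}"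

definition cfun_le :: "'a topology \<Rightarrow> ('a \<Rightarrow> real) \<Rightarrow> ('a \<Rightarrow> real) \<Rightarrow> bool" where
  "cfun_le X f g \<longleftrightarrow> (\<forall>t\<in>topspace X. f t \<le> g t)"

definition cfun_pos :: "'a topology \<Rightarrow> ('a \<Rightarrow> real) set" where
  "cfun_pos X = {f \<in> cfun X. cfun_le X (\<lambda>t\<in>topspace X. 0) f}"

definition cfun_interval ::
    "'a topology \<Rightarrow> ('a \<Rightarrow> real) \<Rightarrow> ('a \<Rightarrow> real) \<Rightarrow> ('a \<Rightarrow> real) set" where
  "cfun_interval X a b = {f \<in> cfun X. cfun_le X a f \<and> cfun_le X f b}"

definition cfun_order_bounded :: "'a topology \<Rightarrow> ('a \<Rightarrow> real) set \<Rightarrow> bool" where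
  "cfun_order_bounded X A \<longleftrightarrow> (\<exists>a\<in>cfun X. \<exists>b\<in>cfun X. A \<subseteq> cfun_interval X a b)"

text \<open>The bound is one-sided, because this notion is meant for subsets of \<open>cfun_pos X\<close>.\<close>

definition cfun_locally_bounded :: "'a topology \<Rightarrow> ('a \<Rightarrow> real) set \<Rightarrow> bool" where
  "cfun_locally_bounded X A \<longleftrightarrow>
     (\<forall>t\<in>topspace X. \<exists>U r. openin X U \<and> t \<in> U \<and> 0 \<le> r \<and> (\<forall>f\<in>A. \<forall>s\<in>U. f s \<le> r))"

end

theory Submission
  imports Defs
begin

text \<open>If \<open>b\<close> is a continuous upper bound of \<open>A\<close>, then near a point \<open>t\<close> every
  \<open>f \<in> A\<close> stays below \<open>b t + 1\<close>; so order boundedness implies local boundedness.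

  For the converse, the open sets on which \<open>A\<close> has a constant bound cover the space, and
  paracompactness makes this cover locally finite: there are open sets \<open>V\<close> with bounds \<open>r V\<close>.
  These bounds are glued to the continuous function \<open>g = (\<Sum>V. r V * h V)\<close>, where \<open>h V\<close> is a
  Urysohn function vanishing off \<open>V\<close> and equal to \<open>1\<close> on a closed subset \<open>C V\<close> of \<open>V\<close>. At a point
  of \<open>C V\<close> the summand of \<open>V\<close> alone already dominates \<open>A\<close>, since the other summands are
  non-negative; hence it suffices that the sets \<open>C V\<close> still cover the space.

  The topological ingredients are Dieudonne's theorem that a paracompact Hausdorff space is
  normal (\<open>paracompact_Hausdorff_imp_normal_space\<close>), which gives the Urysohn functions; the
  closed shrinking of open covers (\<open>paracompact_closed_shrinking\<close>), which gives the sets \<open>C V\<close>;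
  and the continuity of locally finite sums (\<open>continuous_map_locally_finite_sum\<close>).\<close>

section \<open>Separation in paracompact spaces\<close>

lemma paracompact_space_refinement:
  assumes "paracompact_space X" "\<And>U. U \<in> \<U> \<Longrightarrow> openin X U" "\<Union>\<U> = topspace X"
  obtains \<V> where "\<forall>V\<in>\<V>. openin X V" "\<Union>\<V> = topspace X"
    "\<forall>V\<in>\<V>. \<exists>U\<in>\<U>. V \<subseteq> U" "locally_finite_in X \<V>"
proof -
  have "(\<forall>U\<in>\<U>. openin X U) \<and> \<Union>\<U> = topspace X"
    using assms(2,3) by simp
  with assms(1) have "\<exists>\<V>. (\<forall>V\<in>\<V>. openin X V) \<and> \<Union>\<V> = topspace X \<and>
      (\<forall>V\<in>\<V>. \<exists>U\<in>\<U>. V \<subseteq> U) \<and> locally_finite_in X \<V>"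
    unfolding paracompact_space_def by (elim allE impE)
  then show thesis
    by (elim exE conjE) (rule that)
qed

text \<open>The common core of regularity and normality: separating the single points of \<open>S\<close> from \<open>T\<close>
  suffices to separate all of \<open>S\<close> from \<open>T\<close>. The union of the separating neighbourhoods does this
  once the family is locally finite, because closure commutes with locally finite unions.\<close>

lemma paracompact_separate_closed:
  assumes X: "paracompact_space X" and S: "closedin X S"
    and nbhd: "\<And>x. x \<in> S \<Longrightarrow> \<exists>U. openin X U \<and> x \<in> U \<and> disjnt T (X closure_of U)"
  obtains V where "openin X V" "S \<subseteq> V" "disjnt T (X closure_of V)"
proof -
  \<comment> \<open>The complement of \<open>S\<close> turns the neighbourhoods of points of \<open>S\<close> into a cover of the
    space; the members of a refinement that come from it miss \<open>S\<close> and can be discarded.\<close>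
  define \<U> where "\<U> = insert (topspace X - S) {U. openin X U \<and> disjnt T (X closure_of U)}"
  have op: "openin X U" if "U \<in> \<U>" for U
    using S that by (auto simp: \<U>_def)
  have cover: "\<Union>\<U> = topspace X"
  proof
    show "\<Union>\<U> \<subseteq> topspace X"
      using op openin_subset by blast
    show "topspace X \<subseteq> \<Union>\<U>"
    proof
      fix x assume "x \<in> topspace X"
      show "x \<in> \<Union>\<U>"
      proof (cases "x \<in> S")
        case True
        then show ?thesis
          using nbhd[OF True] by (auto simp: \<U>_def)
      next
        case False
        with \<open>x \<in> topspace X\<close> show ?thesis
          by (simp add: \<U>_def)
      qed
    qed
  qed
  obtain \<V> where \<V>: "\<forall>V\<in>\<V>. openin X V" "\<Union>\<V> = topspace X"
      "\<forall>V\<in>\<V>. \<exists>U\<in>\<U>. V \<subseteq> U" "locally_finite_in X \<V>"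
    by (rule paracompact_space_refinement[OF X op cover])
  define \<D> where "\<D> = {V \<in> \<V>. disjnt T (X closure_of V)}"
  have fin: "locally_finite_in X \<D>"
    using \<V>(4) by (rule locally_finite_in_subset) (auto simp: \<D>_def)
  show thesis
  proof
    show "openin X (\<Union>\<D>)"
      using \<V>(1) by (auto simp: \<D>_def)
    show "S \<subseteq> \<Union>\<D>"
    proof
      fix x assume x: "x \<in> S"
      then obtain V where V: "V \<in> \<V>" "x \<in> V"
        using \<V>(2) closedin_subset[OF S] by blast
      then obtain U where U: "U \<in> \<U>" "V \<subseteq> U"
        using \<V>(3) by blast
      then have "disjnt T (X closure_of U)"
        using V x by (auto simp: \<U>_def)
      then have "disjnt T (X closure_of V)"
        using closure_of_mono[OF U(2), of X] by (auto simp: disjnt_iff)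
      with V show "x \<in> \<Union>\<D>"
        by (auto simp: \<D>_def)
    qed
    show "disjnt T (X closure_of \<Union>\<D>)"
      using closure_of_locally_finite_Union[OF fin] by (auto simp: \<D>_def disjnt_iff)
  qed
qed

text \<open>In a Hausdorff space each point of \<open>C\<close> has a neighbourhood whose closure misses \<open>a\<close>,
  so \<open>paracompact_separate_closed\<close> applies with \<open>T = {a}\<close>.\<close>

lemma paracompact_Hausdorff_imp_regular_space:
  assumes "paracompact_space X" "Hausdorff_space X"
  shows "regular_space X"
  unfolding regular_space_def
proof (intro allI impI)
  fix C a
  assume Ca: "closedin X C \<and> a \<in> topspace X - C"
  have "\<exists>U. openin X U \<and> x \<in> U \<and> disjnt {a} (X closure_of U)" if "x \<in> C" for x
  proof -
    have "x \<in> topspace X" "a \<in> topspace X" "x \<noteq> a"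
      using Ca that closedin_subset by blast+
    then obtain U W where "openin X U" "openin X W" "x \<in> U" "a \<in> W" "disjnt U W"
      using assms(2) unfolding Hausdorff_space_def by metis
    then have "W \<inter> X closure_of U = {}"
      by (subst openin_Int_closure_of_eq_empty) (auto simp: disjnt_iff)
    with \<open>openin X U\<close> \<open>x \<in> U\<close> \<open>a \<in> W\<close> show ?thesis
      by (auto simp: disjnt_iff)
  qed
  then obtain V where V: "openin X V" "C \<subseteq> V" "disjnt {a} (X closure_of V)"
    using paracompact_separate_closed[OF assms(1), of C "{a}"] Ca by blast
  show "\<exists>U V. openin X U \<and> openin X V \<and> a \<in> U \<and> C \<subseteq> V \<and> disjnt U V"
  proof (intro exI conjI)
    show "openin X (topspace X - X closure_of V)" "openin X V" "C \<subseteq> V"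
      using V by auto
    show "a \<in> topspace X - X closure_of V"
      using V Ca by simp
    show "disjnt (topspace X - X closure_of V) V"
      using closure_of_subset[OF openin_subset[OF V(1)]] by (auto simp: disjnt_iff)
  qed
qed

text \<open>Regularity now separates each point of \<open>S\<close> from \<open>T\<close>, and
  \<open>paracompact_separate_closed\<close> applies a second time.\<close>

lemma paracompact_Hausdorff_imp_normal_space:
  assumes "paracompact_space X" "Hausdorff_space X"
  shows "normal_space X"
  unfolding normal_space_def
proof (intro allI impI)
  fix S T
  assume "closedin X S \<and> closedin X T \<and> disjnt S T"
  then have S: "closedin X S" and T: "closedin X T" and ST: "disjnt S T"
    by auto
  have "\<exists>U. openin X U \<and> x \<in> U \<and> disjnt T (X closure_of U)" if "x \<in> S" for x
  proof -
    have "x \<in> topspace X - T"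
      using ST that closedin_subset[OF S] by (auto simp: disjnt_iff)
    with T have "closedin X T \<and> x \<in> topspace X - T"
      by blast
    then show ?thesis
      using paracompact_Hausdorff_imp_regular_space[OF assms, unfolded regular_space]
      by (elim allE impE)
  qed
  then obtain V where V: "openin X V" "S \<subseteq> V" "disjnt T (X closure_of V)"
    by (rule paracompact_separate_closed[OF assms(1) S])
  show "\<exists>U V. openin X U \<and> openin X V \<and> S \<subseteq> U \<and> T \<subseteq> V \<and> disjnt U V"
  proof (intro exI conjI)
    show "openin X V" "openin X (topspace X - X closure_of V)" "S \<subseteq> V"
      using V by auto
    show "T \<subseteq> topspace X - X closure_of V"
      using V(3) closedin_subset[OF T] by (auto simp: disjnt_iff)
    show "disjnt V (topspace X - X closure_of V)"
      using closure_of_subset[OF openin_subset[OF V(1)]] by (auto simp: disjnt_iff)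
  qed
qed

section \<open>Closed shrinkings and locally finite sums\<close>

text \<open>By regularity the open sets whose closure lies in some member of \<open>\<V>\<close> also form a cover.
  For a locally finite refinement of that cover, collect in \<open>C V\<close> the closures of those members
  whose closure lies in \<open>V\<close>: local finiteness keeps the union closed.\<close>

lemma paracompact_closed_shrinking:
  assumes X: "paracompact_space X" "Hausdorff_space X"
    and \<V>: "\<And>V. V \<in> \<V> \<Longrightarrow> openin X V" "\<Union>\<V> = topspace X"
  obtains C where "\<forall>V\<in>\<V>. closedin X (C V)" "\<forall>V\<in>\<V>. C V \<subseteq> V"
    "(\<Union>V\<in>\<V>. C V) = topspace X"
proof -
  define \<G> where "\<G> = {G. openin X G \<and> (\<exists>V\<in>\<V>. X closure_of G \<subseteq> V)}"
  have op: "openin X G" if "G \<in> \<G>" for G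
    using that by (auto simp: \<G>_def)
  have cover: "\<Union>\<G> = topspace X"
  proof
    show "\<Union>\<G> \<subseteq> topspace X"
      using op openin_subset by blast
    show "topspace X \<subseteq> \<Union>\<G>"
    proof
      fix x assume "x \<in> topspace X"
      then obtain V where V: "V \<in> \<V>" "x \<in> V"
        using \<V>(2) by blast
      then have "closedin X (topspace X - V) \<and> x \<in> topspace X - (topspace X - V)"
        using \<V> \<open>x \<in> topspace X\<close> by auto
      then have "\<exists>G. openin X G \<and> x \<in> G \<and> disjnt (topspace X - V) (X closure_of G)"
        using paracompact_Hausdorff_imp_regular_space[OF X, unfolded regular_space]
        by (elim allE impE)
      then obtain G where G: "openin X G" "x \<in> G" "disjnt (topspace X - V) (X closure_of G)"
        by blast
      then have "X closure_of G \<subseteq> V"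
        using closure_of_subset_topspace[of X G] by (auto simp: disjnt_iff)
      with G V show "x \<in> \<Union>\<G>"
        by (auto simp: \<G>_def)
    qed
  qed
  obtain \<W> where \<W>: "\<forall>W\<in>\<W>. openin X W" "\<Union>\<W> = topspace X"
      "\<forall>W\<in>\<W>. \<exists>G\<in>\<G>. W \<subseteq> G" "locally_finite_in X \<W>"
    by (rule paracompact_space_refinement[OF X(1) op cover])
  define C where "C V = X closure_of \<Union>{W \<in> \<W>. X closure_of W \<subseteq> V}" for V
  have "closedin X (C V)" for V
    by (simp add: C_def)
  moreover have "C V \<subseteq> V" for V
  proof -
    have "locally_finite_in X {W \<in> \<W>. X closure_of W \<subseteq> V}"
      using \<W>(4) by (rule locally_finite_in_subset) auto
    then show ?thesis
      unfolding C_def by (subst closure_of_locally_finite_Union) auto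
  qed
  moreover have "(\<Union>V\<in>\<V>. C V) = topspace X"
  proof
    show "(\<Union>V\<in>\<V>. C V) \<subseteq> topspace X"
      by (auto simp: C_def dest: subsetD[OF closure_of_subset_topspace])
    show "topspace X \<subseteq> (\<Union>V\<in>\<V>. C V)"
    proof
      fix x assume "x \<in> topspace X"
      then obtain W where W: "W \<in> \<W>" "x \<in> W"
        using \<W>(2) by blast
      then obtain G V where "W \<subseteq> G" "V \<in> \<V>" "X closure_of G \<subseteq> V"
        using \<W>(3) unfolding \<G>_def by blast
      then have WV: "X closure_of W \<subseteq> V" and V: "V \<in> \<V>"
        using closure_of_mono by blast+
      have "x \<in> \<Union>{W \<in> \<W>. X closure_of W \<subseteq> V}"
        using W WV by blast
      moreover have "\<Union>{W \<in> \<W>. X closure_of W \<subseteq> V} \<subseteq> topspace X"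
        using \<W>(2) by blast
      ultimately have "x \<in> C V"
        unfolding C_def using closure_of_subset by blast
      with V show "x \<in> (\<Union>V\<in>\<V>. C V)"
        by blast
    qed
  qed
  ultimately show thesis
    by (intro that ballI)
qed

text \<open>On a neighbourhood that meets only finitely many members of \<open>\<V>\<close>, the sum agrees with a sum
  over one fixed finite index set; the sum over the members containing \<open>x\<close> has an index set
  that varies with \<open>x\<close>, but the missing summands vanish.\<close>

lemma continuous_map_locally_finite_sum:
  fixes \<phi> :: "'a set \<Rightarrow> 'a \<Rightarrow> real"
  assumes \<V>: "locally_finite_in X \<V>"
    and cont: "\<And>V. V \<in> \<V> \<Longrightarrow> continuous_map X euclideanreal (\<phi> V)"
    and zero: "\<And>V x. V \<in> \<V> \<Longrightarrow> x \<in> topspace X - V \<Longrightarrow> \<phi> V x = 0"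
  shows "continuous_map X euclideanreal (\<lambda>x. \<Sum>V | V \<in> \<V> \<and> x \<in> V. \<phi> V x)"
proof -
  obtain N where N: "\<And>t. t \<in> topspace X \<Longrightarrow>
      openin X (N t) \<and> t \<in> N t \<and> finite {V \<in> \<V>. V \<inter> N t \<noteq> {}}"
    using \<V> unfolding locally_finite_in_def by metis
  have local: "(\<Sum>V | V \<in> \<V> \<and> x \<in> V. \<phi> V x) = (\<Sum>V | V \<in> \<V> \<and> V \<inter> N t \<noteq> {}. \<phi> V x)"
    if "t \<in> topspace X" "x \<in> topspace X" "x \<in> N t" for t x
    by (rule sum.mono_neutral_left) (use N that zero in auto)
  show ?thesis
  proof (rule pasting_lemma)
    show "openin X (N t)" if "t \<in> topspace X" for t
      using N that by blast
    show "continuous_map (subtopology X (N t)) euclideanreal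
        (\<lambda>x. \<Sum>V | V \<in> \<V> \<and> V \<inter> N t \<noteq> {}. \<phi> V x)" if "t \<in> topspace X" for t
      using N[OF that] cont
      by (intro continuous_map_from_subtopology continuous_map_sum) auto
  next
    fix s t x
    assume "s \<in> topspace X" "t \<in> topspace X" "x \<in> topspace X \<inter> N s \<inter> N t"
    then show "(\<Sum>V | V \<in> \<V> \<and> V \<inter> N s \<noteq> {}. \<phi> V x) = (\<Sum>V | V \<in> \<V> \<and> V \<inter> N t \<noteq> {}. \<phi> V x)"
      using local[of s x] local[of t x] by simp
  next
    fix x assume "x \<in> topspace X"
    then show "\<exists>t. t \<in> topspace X \<and> x \<in> N t \<and>
        (\<Sum>V | V \<in> \<V> \<and> x \<in> V. \<phi> V x) = (\<Sum>V | V \<in> \<V> \<and> V \<inter> N t \<noteq> {}. \<phi> V x)"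
      using N local by blast
  qed
qed

section \<open>Local boundedness and order boundedness\<close>

text \<open>Gluing of the local bounds to \<open>g = (\<Sum>V. r V * h V)\<close>. The sign condition \<open>0 \<le> r V\<close>
  prevents the other summands from pulling \<open>g\<close> below \<open>r V\<close> on \<open>C V\<close>.\<close>

lemma paracompact_continuous_majorant:
  assumes X: "paracompact_space X" "Hausdorff_space X"
    and bdd: "cfun_locally_bounded X A"
  obtains g where "g \<in> cfun X" "\<And>f. f \<in> A \<Longrightarrow> cfun_le X f g"
proof -
  define \<U> where "\<U> = {U. openin X U \<and> (\<exists>r\<ge>0. \<forall>f\<in>A. \<forall>s\<in>U. f s \<le> r)}"
  have op: "openin X U" if "U \<in> \<U>" for U
    using that by (auto simp: \<U>_def)
  have cover: "\<Union>\<U> = topspace X"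
  proof
    show "\<Union>\<U> \<subseteq> topspace X"
      using op openin_subset by blast
    show "topspace X \<subseteq> \<Union>\<U>"
      using bdd unfolding cfun_locally_bounded_def \<U>_def by fastforce
  qed
  obtain \<V> where \<V>: "\<forall>V\<in>\<V>. openin X V" "\<Union>\<V> = topspace X"
      "\<forall>V\<in>\<V>. \<exists>U\<in>\<U>. V \<subseteq> U" "locally_finite_in X \<V>"
    by (rule paracompact_space_refinement[OF X(1) op cover])
  have "\<forall>V\<in>\<V>. \<exists>r. 0 \<le> r \<and> (\<forall>f\<in>A. \<forall>s\<in>V. f s \<le> r)"
  proof
    fix V assume "V \<in> \<V>"
    then obtain U where "U \<in> \<U>" "V \<subseteq> U"
      using \<V>(3) by blast
    then obtain r where "0 \<le> r" "\<forall>f\<in>A. \<forall>s\<in>U. f s \<le> r"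
      unfolding \<U>_def by blast
    with \<open>V \<subseteq> U\<close> show "\<exists>r. 0 \<le> r \<and> (\<forall>f\<in>A. \<forall>s\<in>V. f s \<le> r)"
      by blast
  qed
  from bchoice[OF this] obtain r where
    r_spec: "\<forall>V\<in>\<V>. 0 \<le> r V \<and> (\<forall>f\<in>A. \<forall>s\<in>V. f s \<le> r V)"
    by (elim exE)
  have r: "0 \<le> r V" "f \<in> A \<Longrightarrow> s \<in> V \<Longrightarrow> f s \<le> r V" if "V \<in> \<V>" for V f s
    using r_spec that by simp_all
  obtain C where C: "\<forall>V\<in>\<V>. closedin X (C V)" "\<forall>V\<in>\<V>. C V \<subseteq> V"
      "(\<Union>V\<in>\<V>. C V) = topspace X"
    by (rule paracompact_closed_shrinking[OF X \<V>(1)[rule_format] \<V>(2)])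
  have "\<forall>V\<in>\<V>. \<exists>h. continuous_map X (top_of_set {0..1::real}) h \<and>
      h ` (topspace X - V) \<subseteq> {0} \<and> h ` C V \<subseteq> {1}"
  proof
    fix V assume V: "V \<in> \<V>"
    have "closedin X (topspace X - V)"
      using \<V>(1) V by blast
    moreover have "disjnt (topspace X - V) (C V)"
      using bspec[OF C(2) V] by (auto simp: disjnt_iff)
    ultimately obtain h where "continuous_map X (top_of_set {0..1::real}) h"
        "h ` (topspace X - V) \<subseteq> {0}" "h ` C V \<subseteq> {1}"
      by (rule Urysohn_lemma[OF paracompact_Hausdorff_imp_normal_space[OF X] _ bspec[OF C(1) V],
            where a = 0 and b = 1]) simp_all
    then show "\<exists>h. continuous_map X (top_of_set {0..1::real}) h \<and>
        h ` (topspace X - V) \<subseteq> {0} \<and> h ` C V \<subseteq> {1}"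
      by (intro exI conjI)
  qed
  from bchoice[OF this] obtain h where
    h_spec: "\<forall>V\<in>\<V>. continuous_map X (top_of_set {0..1::real}) (h V) \<and>
      h V ` (topspace X - V) \<subseteq> {0} \<and> h V ` C V \<subseteq> {1}"
    by (elim exE)
  have h: "continuous_map X (top_of_set {0..1::real}) (h V)"
      "h V ` (topspace X - V) \<subseteq> {0}" "h V ` C V \<subseteq> {1}" if "V \<in> \<V>" for V
    using h_spec that by simp_all
  have hcont: "continuous_map X euclideanreal (h V)"
    and hnonneg: "\<And>x. x \<in> topspace X \<Longrightarrow> 0 \<le> h V x" if "V \<in> \<V>" for V
    using h(1)[OF that] by (auto simp: continuous_map_in_subtopology)
  define g where "g x = (\<Sum>V | V \<in> \<V> \<and> x \<in> V. r V * h V x)" for x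
  have gcont: "continuous_map X euclideanreal g"
    unfolding g_def
  proof (rule continuous_map_locally_finite_sum[OF \<V>(4)])
    show "continuous_map X euclideanreal (\<lambda>x. r V * h V x)" if "V \<in> \<V>" for V
      using hcont[OF that] by (intro continuous_map_real_mult) auto
    show "r V * h V x = 0" if "V \<in> \<V>" "x \<in> topspace X - V" for V x
      using h(2) that by force
  qed
  have le: "f x \<le> g x" if f: "f \<in> A" and x: "x \<in> topspace X" for f x
  proof -
    obtain V where V: "V \<in> \<V>" "x \<in> C V"
      using C(3) x by blast
    then have xV: "x \<in> V"
      using C(2) by blast
    have fin: "finite {V \<in> \<V>. x \<in> V}"
    proof -
      obtain N where "x \<in> N" "finite {V \<in> \<V>. V \<inter> N \<noteq> {}}"
        using \<V>(4) x unfolding locally_finite_in_def by blast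
      then show ?thesis
        by (auto elim!: rev_finite_subset)
    qed
    have "h V x = 1"
      using h(3)[OF V(1)] V(2) by blast
    then have "f x \<le> r V * h V x"
      using r(2)[OF V(1) f xV] by simp
    also have "\<dots> \<le> g x"
      unfolding g_def
      by (rule member_le_sum) (use V xV fin r(1) hnonneg x in auto)
    finally show ?thesis .
  qed
  show thesis
  proof
    \<comment> \<open>Members of \<open>cfun X\<close> are extensional, so \<open>g\<close> is cut off outside the space.\<close>
    show "restrict g (topspace X) \<in> cfun X"
      unfolding cfun_def using gcont by (auto intro: continuous_map_eq)
    show "cfun_le X f (restrict g (topspace X))" if "f \<in> A" for f
      using le[OF that] by (simp add: cfun_le_def)
  qed
qed

lemma cfun_order_bounded_imp_locally_bounded:
  assumes "cfun_order_bounded X A"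
  shows "cfun_locally_bounded X A"
  unfolding cfun_locally_bounded_def
proof
  obtain b where b: "continuous_map X euclideanreal b"
      "\<And>f s. f \<in> A \<Longrightarrow> s \<in> topspace X \<Longrightarrow> f s \<le> b s"
    using assms unfolding cfun_order_bounded_def cfun_interval_def cfun_le_def cfun_def by blast
  fix t assume t: "t \<in> topspace X"
  show "\<exists>U r. openin X U \<and> t \<in> U \<and> 0 \<le> r \<and> (\<forall>f\<in>A. \<forall>s\<in>U. f s \<le> r)"
  proof (intro exI conjI ballI)
    \<comment> \<open>The maximum with \<open>0\<close> is taken because \<open>b t + 1\<close> may be negative.\<close>
    show "openin X {s \<in> topspace X. b s \<in> {..<b t + 1}}"
      using b(1) by (rule openin_continuous_map_preimage) auto
    show "t \<in> {s \<in> topspace X. b s \<in> {..<b t + 1}}"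
      using t by simp
    show "0 \<le> max 0 (b t + 1)"
      by simp
    show "f s \<le> max 0 (b t + 1)" if "f \<in> A" "s \<in> {s \<in> topspace X. b s \<in> {..<b t + 1}}" for f s
      using b(2)[of f s] that by auto
  qed
qed

theorem proposition3p4:
  fixes \<Omega> :: "'a topology" and A :: "('a \<Rightarrow> real) set"
  assumes "paracompact_space \<Omega>" and "Hausdorff_space \<Omega>"
    and "A \<subseteq> cfun_pos \<Omega>"
  shows "cfun_order_bounded \<Omega> A \<longleftrightarrow> cfun_locally_bounded \<Omega> A"
proof
  assume "cfun_order_bounded \<Omega> A"
  then show "cfun_locally_bounded \<Omega> A"
    by (rule cfun_order_bounded_imp_locally_bounded)
next
  assume "cfun_locally_bounded \<Omega> A"
  then obtain g where g: "g \<in> cfun \<Omega>" "\<And>f. f \<in> A \<Longrightarrow> cfun_le \<Omega> f g"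
    using paracompact_continuous_majorant[OF assms(1,2)] by blast
  have "(\<lambda>t\<in>topspace \<Omega>. 0) \<in> cfun \<Omega>"
    unfolding cfun_def by (auto intro: continuous_map_eq[of _ _ "\<lambda>t. 0"])
  moreover have "A \<subseteq> cfun_interval \<Omega> (\<lambda>t\<in>topspace \<Omega>. 0) g"
    using assms(3) g(2) by (auto simp: cfun_interval_def cfun_pos_def)
  ultimately show "cfun_order_bounded \<Omega> A"
    unfolding cfun_order_bounded_def using g(1) by blast
qed

end
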